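(* Let $L$ be a complete chain (a totally ordered complete lattice, regarded as a frame). Then the frame $\mathbb{C}L$ of frame congruences on $L$ is Boolean if and only if $L$ is well-ordered.
   Context: A congruence on a frame $L$ is an equivalence relation on $L$ that is closed under finite meets and arbitrary joins in $L\times L$. The congruences on $L$, ordered by inclusion, form a frame $\mathbb{C}L$. A frame is Boolean if every element is complemented. *)

theory Defs
  imports "HOL-Library.Product_Order"
begin

text \<open>The library's \<open>complete_distrib_lattice\<close> asks for complete distributivity, which is
  stronger than the frame law.\<close>

class frame = complete_lattice +
  assumes inf_Sup_frame: "inf a (Sup B) = Sup (inf a ` B)"

subclass (in complete_linorder) frame
proof
  fix a :: 'a and B :: "'a set"
  show "inf a (Sup B) = Sup (inf a ` B)"
    by (rule inf_Sup)
qed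

definition complemented :: "'a::bounded_lattice \<Rightarrow> bool" where
  "complemented a \<longleftrightarrow> (\<exists>b. inf a b = bot \<and> sup a b = top)"

definition boolean_frame :: "'a::frame itself \<Rightarrow> bool" where
  "boolean_frame T \<longleftrightarrow> (\<forall>a::'a. complemented a)"

text \<open>\<open>Inf\<close> and \<open>Sup\<close> below are those of the product order on pairs (\<open>Product_Order\<close>); the
  set \<open>S\<close> may be empty.\<close>

definition frame_congruence :: "('a::frame \<times> 'a) set \<Rightarrow> bool" where
  "frame_congruence R \<longleftrightarrow> equiv UNIV R
     \<and> (\<forall>S. finite S \<and> S \<subseteq> R \<longrightarrow> Inf S \<in> R)
     \<and> (\<forall>S. S \<subseteq> R \<longrightarrow> Sup S \<in> R)"

lemma congruence_Inf:
  assumes "frame_congruence R" "finite S" "S \<subseteq> R" shows "Inf S \<in> R"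
  using assms by (auto simp: frame_congruence_def)

lemma congruence_Sup:
  assumes "frame_congruence R" "S \<subseteq> R" shows "Sup S \<in> R"
  using assms by (auto simp: frame_congruence_def)

lemma congruence_refl: "frame_congruence R \<Longrightarrow> (a, a) \<in> R"
  by (auto simp: frame_congruence_def equiv_def refl_on_def)

lemma congruence_sym: "frame_congruence R \<Longrightarrow> (a, b) \<in> R \<Longrightarrow> (b, a) \<in> R"
  by (auto simp: frame_congruence_def equiv_def dest: symD)

lemma congruence_trans:
  "frame_congruence R \<Longrightarrow> (a, b) \<in> R \<Longrightarrow> (b, c) \<in> R \<Longrightarrow> (a, c) \<in> R"
  unfolding frame_congruence_def equiv_def by (meson transD)

lemma congruence_inf:
  assumes "frame_congruence R" "(a, b) \<in> R" "(c, d) \<in> R"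
  shows "(inf a c, inf b d) \<in> R"
  using congruence_Inf[OF assms(1), of "{(a, b), (c, d)}"] assms by simp

lemma congruence_sup:
  assumes "frame_congruence R" "(a, b) \<in> R" "(c, d) \<in> R"
  shows "(sup a c, sup b d) \<in> R"
  using congruence_Sup[OF assms(1), of "{(a, b), (c, d)}"] assms by simp

lemma frame_congruence_UNIV: "frame_congruence UNIV"
  by (auto simp: frame_congruence_def equiv_def refl_on_def sym_def trans_def)

lemma frame_congruence_Inter:
  assumes "\<And>R. R \<in> F \<Longrightarrow> frame_congruence R"
  shows "frame_congruence (\<Inter>F)"
  unfolding frame_congruence_def
proof (intro conjI allI impI)
  show "equiv UNIV (\<Inter>F)"
  proof (rule equivI)
    show "refl (\<Inter>F)"
      by (intro refl_onI InterI congruence_refl assms)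
    show "sym (\<Inter>F)"
    proof (intro symI InterI)
      fix a b R
      assume "(a, b) \<in> \<Inter>F" "R \<in> F"
      then show "(b, a) \<in> R"
        by (auto intro: congruence_sym[OF assms, of R a b])
    qed
    show "trans (\<Inter>F)"
    proof (intro transI InterI)
      fix a b c R
      assume "(a, b) \<in> \<Inter>F" "(b, c) \<in> \<Inter>F" "R \<in> F"
      then show "(a, c) \<in> R"
        by (auto intro: congruence_trans[OF assms, of R a b c])
    qed
  qed simp
  show "Inf S \<in> \<Inter>F" if "finite S \<and> S \<subseteq> \<Inter>F" for S
  proof
    fix R assume R: "R \<in> F"
    show "Inf S \<in> R"
      using that R by (intro congruence_Inf[OF assms[OF R]]) auto
  qed
  show "Sup S \<in> \<Inter>F" if "S \<subseteq> \<Inter>F" for S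
  proof
    fix R assume R: "R \<in> F"
    show "Sup S \<in> R"
      using that R by (intro congruence_Sup[OF assms[OF R]]) auto
  qed
qed

typedef (overloaded) 'a congruence = "{R :: ('a::frame \<times> 'a) set. frame_congruence R}"
  morphisms rel Congruence
  using frame_congruence_UNIV by blast

setup_lifting type_definition_congruence

lemma frame_congruence_rel: "frame_congruence (rel t)"
  using rel by blast

instantiation congruence :: (frame) complete_lattice
begin

lift_definition less_eq_congruence :: "'a congruence \<Rightarrow> 'a congruence \<Rightarrow> bool"
  is "(\<subseteq>)" .

lift_definition less_congruence :: "'a congruence \<Rightarrow> 'a congruence \<Rightarrow> bool"
  is "(\<subset>)" .

lift_definition Inf_congruence :: "'a congruence set \<Rightarrow> 'a congruence"
  is "\<lambda>F. \<Inter>F" by (rule frame_congruence_Inter) auto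

lift_definition inf_congruence :: "'a congruence \<Rightarrow> 'a congruence \<Rightarrow> 'a congruence"
  is "(\<inter>)"
  subgoal for R R'
    using frame_congruence_Inter[of "{R, R'}"] by auto
  done

lift_definition top_congruence :: "'a congruence"
  is UNIV by (rule frame_congruence_UNIV)

definition Sup_congruence :: "'a congruence set \<Rightarrow> 'a congruence" where
  "Sup_congruence F = Inf {t. \<forall>s\<in>F. s \<le> t}"

definition sup_congruence :: "'a congruence \<Rightarrow> 'a congruence \<Rightarrow> 'a congruence" where
  "sup_congruence s t = Inf {u. s \<le> u \<and> t \<le> u}"

definition bot_congruence :: "'a congruence" where
  "bot_congruence = Inf UNIV"

instance
proof
  fix x y z :: "'a congruence" and A :: "'a congruence set"
  have Inf_lower: "Inf B \<le> u" if "u \<in> B" for u and B :: "'a congruence set"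
    using that by transfer auto
  have Inf_greatest: "u \<le> Inf B" if "\<And>v. v \<in> B \<Longrightarrow> u \<le> v" for u and B :: "'a congruence set"
    using that by (simp add: less_eq_congruence.rep_eq Inf_congruence.rep_eq le_Inf_iff)
  show "x < y \<longleftrightarrow> x \<le> y \<and> \<not> y \<le> x" by transfer auto
  show "x \<le> x" by transfer auto
  show "x \<le> z" if "x \<le> y" "y \<le> z" using that by transfer auto
  show "x = y" if "x \<le> y" "y \<le> x" using that by transfer auto
  show "inf x y \<le> x" by transfer auto
  show "inf x y \<le> y" by transfer auto
  show "x \<le> inf y z" if "x \<le> y" "x \<le> z" using that by transfer auto
  show "x \<le> sup x y" unfolding sup_congruence_def by (rule Inf_greatest) auto
  show "y \<le> sup x y" unfolding sup_congruence_def by (rule Inf_greatest) auto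
  show "sup y z \<le> x" if "y \<le> x" "z \<le> x"
    unfolding sup_congruence_def using that by (intro Inf_lower) auto
  show "Inf A \<le> x" if "x \<in> A" using that by (rule Inf_lower)
  show "z \<le> Inf A" if "\<And>x. x \<in> A \<Longrightarrow> z \<le> x" using that by (rule Inf_greatest)
  show "x \<le> Sup A" if "x \<in> A"
    unfolding Sup_congruence_def using that by (intro Inf_greatest) auto
  show "Sup A \<le> z" if "\<And>x. x \<in> A \<Longrightarrow> x \<le> z"
    unfolding Sup_congruence_def using that by (intro Inf_lower) auto
  show "Inf {} = (top :: 'a congruence)" by transfer auto
  show "Sup {} = (bot :: 'a congruence)"
    unfolding Sup_congruence_def bot_congruence_def by simp
qed

end

lemma frame_inf_sup_distrib:
  "inf a (sup b c) = sup (inf a b) (inf a (c :: 'a::frame))"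
  using inf_Sup_frame[of a "{b, c}"] by simp

lemma frame_congruenceI:
  assumes refl: "\<And>a. (a, a) \<in> R"
    and sym: "\<And>a b. (a, b) \<in> R \<Longrightarrow> (b, a) \<in> R"
    and trans: "\<And>a b c. (a, b) \<in> R \<Longrightarrow> (b, c) \<in> R \<Longrightarrow> (a, c) \<in> R"
    and inf: "\<And>a b c d. (a, b) \<in> R \<Longrightarrow> (c, d) \<in> R \<Longrightarrow> (inf a c, inf b d) \<in> R"
    and Sup: "\<And>S. S \<subseteq> R \<Longrightarrow> (Sup (fst ` S), Sup (snd ` S)) \<in> R"
  shows "frame_congruence R"
  unfolding frame_congruence_def
proof (intro conjI allI impI)
  show "equiv UNIV R"
  proof (rule equivI)
    show "refl R" by (rule refl_onI) (rule refl)
    show "sym R" by (rule symI) (rule sym)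
    show "trans R" by (rule transI) (rule trans)
  qed simp
  show "Sup S \<in> R" if "S \<subseteq> R" for S
    using Sup[OF that] by (simp add: Sup_prod_def)
  show "Inf S \<in> R" if "finite S \<and> S \<subseteq> R" for S
  proof -
    from that have "finite S" "S \<subseteq> R" by auto
    then show ?thesis
    proof (induction S rule: finite_induct)
      case empty
      then show ?case by (simp add: refl top_prod_def)
    next
      case (insert p S)
      then show ?case
        using inf[of "fst p" "snd p" "fst (Inf S)" "snd (Inf S)"] by (simp add: inf_prod_def)
    qed
  qed
qed

text \<open>The Heyting implication of congruences; its existence gives the frame law.\<close>

definition congruence_imp :: "('a::frame \<times> 'a) set \<Rightarrow> ('a \<times> 'a) set \<Rightarrow> ('a \<times> 'a) set" where
  "congruence_imp Q R =
     {(a, b). \<forall>x y. (x, y) \<in> Q \<longrightarrow> x \<le> y \<longrightarrow> (sup (inf y a) x, sup (inf y b) x) \<in> R}"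

lemma frame_sup_inf_distrib:
  fixes a b c :: "'a::frame"
  shows "sup (inf a b) c = inf (sup a c) (sup b c)"
proof -
  have "inf (sup a c) (sup b c) = sup (inf (sup a c) b) (inf (sup a c) c)"
    by (rule frame_inf_sup_distrib)
  also have "inf (sup a c) b = sup (inf a b) (inf c b)"
    using frame_inf_sup_distrib[of b a c] by (simp add: inf.commute)
  also have "inf (sup a c) c = c"
    by (simp add: inf_absorb2)
  also have "sup (sup (inf a b) (inf c b)) c = sup (inf a b) c"
    by (simp add: sup.assoc sup_absorb2)
  finally show ?thesis by simp
qed

lemma sup_inf_Sup_frame:
  fixes x y :: "'a::frame"
  shows "sup (inf y (Sup A)) x = Sup (insert x ((\<lambda>a. sup (inf y a) x) ` A))"
proof -
  have "inf y a \<le> Sup (insert x ((\<lambda>a. sup (inf y a) x) ` A))" if "a \<in> A" for a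
    using that by (intro Sup_upper2[of "sup (inf y a) x"]) auto
  then have "Sup (inf y ` A) \<le> Sup (insert x ((\<lambda>a. sup (inf y a) x) ` A))"
    by (rule SUP_least)
  then have "sup (Sup (inf y ` A)) x \<le> Sup (insert x ((\<lambda>a. sup (inf y a) x) ` A))"
    by simp
  moreover have "Sup (insert x ((\<lambda>a. sup (inf y a) x) ` A)) \<le> sup (Sup (inf y ` A)) x"
  proof -
    have "inf y a \<le> sup (Sup (inf y ` A)) x" if "a \<in> A" for a
      by (rule le_supI1, rule SUP_upper, rule that)
    then show ?thesis
      by (intro Sup_least) auto
  qed
  ultimately show ?thesis
    unfolding inf_Sup_frame by (rule antisym)
qed

lemma frame_congruence_imp:
  assumes R: "frame_congruence R"
  shows "frame_congruence (congruence_imp Q R)"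
proof (rule frame_congruenceI)
  show "(a, a) \<in> congruence_imp Q R" for a
    by (simp add: congruence_imp_def congruence_refl[OF R])
  show "(b, a) \<in> congruence_imp Q R" if "(a, b) \<in> congruence_imp Q R" for a b
    using that by (simp add: congruence_imp_def congruence_sym[OF R])
  show "(a, c) \<in> congruence_imp Q R"
    if "(a, b) \<in> congruence_imp Q R" "(b, c) \<in> congruence_imp Q R" for a b c
    using that unfolding congruence_imp_def by (blast intro: congruence_trans[OF R])
  show "(inf a c, inf b d) \<in> congruence_imp Q R"
    if ab: "(a, b) \<in> congruence_imp Q R" and cd: "(c, d) \<in> congruence_imp Q R" for a b c d
  proof -
    have eq: "sup (inf y (inf u v)) x = inf (sup (inf y u) x) (sup (inf y v) x)" for x y u v :: 'a
      by (simp add: frame_sup_inf_distrib inf_aci)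
    show ?thesis
      using ab cd by (simp add: congruence_imp_def eq congruence_inf[OF R])
  qed
  show "(Sup (fst ` S), Sup (snd ` S)) \<in> congruence_imp Q R" if S: "S \<subseteq> congruence_imp Q R" for S
  proof -
    have "(sup (inf y (Sup (fst ` S))) x, sup (inf y (Sup (snd ` S))) x) \<in> R"
      if "(x, y) \<in> Q" "x \<le> y" for x y
    proof -
      let ?T = "insert (x, x) ((\<lambda>p. (sup (inf y (fst p)) x, sup (inf y (snd p)) x)) ` S)"
      have "?T \<subseteq> R"
        using S that by (fastforce simp: congruence_imp_def congruence_refl[OF R])
      then have "Sup ?T \<in> R"
        by (rule congruence_Sup[OF R])
      then show ?thesis
        by (simp add: sup_inf_Sup_frame Sup_prod_def image_image)
    qed
    then show ?thesis
      by (simp add: congruence_imp_def)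
  qed
qed

lemma congruence_imp_mp:
  assumes Q: "frame_congruence Q" and R: "frame_congruence R"
  shows "Q \<inter> congruence_imp Q R \<subseteq> R"
proof
  fix p assume "p \<in> Q \<inter> congruence_imp Q R"
  then obtain a b where p: "p = (a, b)" and abQ: "(a, b) \<in> Q"
    and ab: "(a, b) \<in> congruence_imp Q R"
    by (cases p) auto
  have ba: "(b, a) \<in> congruence_imp Q R"
    using ab by (rule congruence_sym[OF frame_congruence_imp[OF R]])
  have aQ: "(a, sup a b) \<in> Q"
    using congruence_sup[OF Q congruence_refl[OF Q, of a] abQ] by simp
  have bQ: "(b, sup a b) \<in> Q"
    using congruence_trans[OF Q congruence_sym[OF Q abQ] aQ] .
  have "(sup (inf (sup a b) a) a, sup (inf (sup a b) b) a) \<in> R"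
    using ab aQ unfolding congruence_imp_def by auto
  then have 1: "(a, sup a b) \<in> R"
    by (simp add: inf_absorb2 sup.commute)
  have "(sup (inf (sup a b) b) b, sup (inf (sup a b) a) b) \<in> R"
    using ba bQ unfolding congruence_imp_def by auto
  then have 2: "(b, sup a b) \<in> R"
    by (simp add: inf_absorb2 sup.commute)
  show "p \<in> R"
    unfolding p by (rule congruence_trans[OF R 1 congruence_sym[OF R 2]])
qed

lemma congruence_imp_greatest:
  assumes Q: "frame_congruence Q" and P: "frame_congruence P" and le: "Q \<inter> P \<subseteq> R"
  shows "P \<subseteq> congruence_imp Q R"
proof
  fix p assume "p \<in> P"
  then obtain a b where p: "p = (a, b)" and ab: "(a, b) \<in> P"
    by (cases p) auto
  have "(sup (inf y a) x, sup (inf y b) x) \<in> R" if xy: "(x, y) \<in> Q" "x \<le> y" for x y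
  proof -
    have "(sup (inf y a) x, sup (inf y b) x) \<in> P"
      using ab by (intro congruence_sup[OF P] congruence_inf[OF P] congruence_refl[OF P])
    moreover have Qx: "(sup (inf y c) x, y) \<in> Q" for c
    proof -
      have "(sup (inf y c) x, sup (inf y c) y) \<in> Q"
        using xy by (intro congruence_sup[OF Q] congruence_refl[OF Q])
      then show ?thesis by (simp add: sup_absorb2)
    qed
    moreover have "(sup (inf y a) x, sup (inf y b) x) \<in> Q"
      using congruence_trans[OF Q Qx congruence_sym[OF Q Qx]] .
    ultimately show ?thesis using le by blast
  qed
  then show "p \<in> congruence_imp Q R"
    unfolding p congruence_imp_def by simp
qed

instance congruence :: (frame) frame
proof
  fix t :: "'a congruence" and F :: "'a congruence set"
  let ?s = "Sup (inf t ` F)"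
  define w where "w = Congruence (congruence_imp (rel t) (rel ?s))"
  have rel_w: "rel w = congruence_imp (rel t) (rel ?s)"
    unfolding w_def
    by (simp add: Congruence_inverse frame_congruence_imp frame_congruence_rel)
  have "f \<le> w" if "f \<in> F" for f
  proof -
    have "inf t f \<le> ?s"
      using that by (intro Sup_upper) auto
    then have "rel t \<inter> rel f \<subseteq> rel ?s"
      by (simp only: less_eq_congruence.rep_eq inf_congruence.rep_eq)
    then show ?thesis
      by (simp add: less_eq_congruence.rep_eq rel_w congruence_imp_greatest frame_congruence_rel)
  qed
  then have "Sup F \<le> w"
    by (rule Sup_least)
  then have "inf t (Sup F) \<le> inf t w"
    by (rule inf_mono[OF order_refl])
  also have "inf t w \<le> ?s"
    unfolding less_eq_congruence.rep_eq inf_congruence.rep_eq rel_w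
    by (intro congruence_imp_mp frame_congruence_rel)
  finally have "inf t (Sup F) \<le> ?s" .
  moreover have "?s \<le> inf t (Sup F)"
    by (auto intro!: Sup_least intro: Sup_upper le_infI2)
  ultimately show "inf t (Sup F) = ?s"
    by (rule antisym)
qed

end

theory Submission
  imports Defs
begin

text \<open>
  Both properties amount to a third one: every element of the complete chain other than \<open>top\<close> has
  an immediate successor. For well-ordering this holds because a nonempty set without a least
  element has an infimum outside it, and that infimum has no successor
  (\<open>well_order_iff_successors\<close>).

  The congruences used are those of the form \<open>cut_congruence X\<close>, which identify two elements when no
  member of \<open>X\<close> separates them. If \<open>a \<noteq> top\<close> has no immediate successor, then \<open>cut_congruence {a}\<close>,
  with the two classes \<open>{..a}\<close> and \<open>{a<..}\<close>, has no complement: a congruence disjoint from it is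
  trivial on both classes, and could only relate some \<open>x \<le> a\<close> to some \<open>y > a\<close>; but then by
  convexity it would relate \<open>y\<close> to the elements strictly between \<open>a\<close> and \<open>y\<close>, which exist and share the class
  of \<open>y\<close>. Conversely, if
  successors exist and \<open>M\<close> consists of the elements that are greatest in their class under a
  congruence \<open>t\<close>, then \<open>cut_congruence (- M)\<close> is a complement of \<open>t\<close>: at every \<open>m \<noteq> top\<close>, either \<open>t\<close>
  (if \<open>m \<notin> M\<close>) or \<open>cut_congruence (- M)\<close> (if \<open>m \<in> M\<close>) relates \<open>m\<close> to something larger, so no class
  of their join can have a greatest element below \<open>top\<close>. As classes contain their suprema
  (\<open>rel_class_Sup\<close>), there is only one class.
\<close>

lemma rel_top: "rel (top :: 'a::frame congruence) = UNIV"
  by (rule top_congruence.rep_eq)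

lemma rel_bot: "rel (bot :: 'a::frame congruence) = Id"
proof
  have "frame_congruence (Id :: ('a \<times> 'a) set)"
  proof (rule frame_congruenceI)
    fix S :: "('a \<times> 'a) set"
    assume "S \<subseteq> Id"
    then have "fst ` S = snd ` S"
      by (intro image_cong) auto
    then show "(Sup (fst ` S), Sup (snd ` S)) \<in> Id"
      by simp
  qed auto
  then have "rel (Congruence (Id :: ('a \<times> 'a) set)) = Id"
    by (simp add: Congruence_inverse)
  then show "rel (bot :: 'a congruence) \<subseteq> Id"
    using bot_least[of "Congruence (Id :: ('a \<times> 'a) set)"] by (simp add: less_eq_congruence.rep_eq)
  show "Id \<subseteq> rel (bot :: 'a congruence)"
    using congruence_refl[OF frame_congruence_rel] by auto
qed

lemma rel_convex:
  fixes t :: "'a::frame congruence"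
  assumes "(x, y) \<in> rel t" "x \<le> c" "c \<le> y"
  shows "(c, y) \<in> rel t"
  using congruence_sup[OF frame_congruence_rel[of t] congruence_refl[OF frame_congruence_rel] assms(1), of c]
    assms(2,3) by (simp add: sup_absorb1 sup_absorb2)

lemma rel_class_Sup:
  fixes t :: "'a::frame congruence"
  shows "(a, Sup {b. (a, b) \<in> rel t}) \<in> rel t"
proof -
  let ?B = "{b. (a, b) \<in> rel t}"
  have "?B \<noteq> {}"
    using congruence_refl[OF frame_congruence_rel] by auto
  then have "Sup (Pair a ` ?B) = (a, Sup ?B)"
    by (simp only: Sup_prod_def image_image fst_conv snd_conv SUP_const image_ident not_False_eq_True)
  moreover have "Sup (Pair a ` ?B) \<in> rel t"
    by (rule congruence_Sup[OF frame_congruence_rel]) auto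
  ultimately show ?thesis
    by simp
qed

text \<open>In a chain each \<open>{..x}\<close> is a prime ideal closed under arbitrary joins, so membership in it
  is preserved by finite meets and arbitrary joins.\<close>

lift_definition cut_congruence :: "'a::complete_linorder set \<Rightarrow> 'a congruence"
  is "\<lambda>X. {(a, b). \<forall>x\<in>X. a \<le> x \<longleftrightarrow> b \<le> x}"
proof (rule frame_congruenceI, goal_cases)
  case (4 X a b c d)
  then show ?case
    by (auto simp: inf_min min_le_iff_disj)
next
  case (5 X S)
  then show ?case
    by (fastforce simp: Sup_le_iff)
qed auto

definition has_successors :: "'a::complete_linorder itself \<Rightarrow> bool" where
  "has_successors T \<longleftrightarrow> (\<forall>a::'a. a \<noteq> top \<longrightarrow> (\<exists>n>a. \<forall>x>a. n \<le> x))"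

lemma well_order_iff_successors:
  "well_order {(x :: 'a::complete_linorder, y). x \<le> y} \<longleftrightarrow> has_successors TYPE('a)"
proof -
  have strict: "{(x :: 'a, y). x \<le> y} - Id = {(x, y). x < y}"
    by auto
  have "linear_order {(x :: 'a, y). x \<le> y}"
    by (auto simp: order_on_defs refl_on_def trans_def antisym_def total_on_def)
  then have "well_order {(x :: 'a, y). x \<le> y} \<longleftrightarrow> wf {(x :: 'a, y). x < y}"
    by (simp add: well_order_on_def strict)
  also have "\<dots> \<longleftrightarrow> has_successors TYPE('a)"
  proof
    assume wf: "wf {(x :: 'a, y). x < y}"
    show "has_successors TYPE('a)"
      unfolding has_successors_def
    proof (intro allI impI)
      fix a :: 'a
      assume "a \<noteq> top"
      then have "top \<in> {a<..}"
        by (simp add: top.not_eq_extremum)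
      then obtain n where "n \<in> {a<..}" "\<And>y. y < n \<Longrightarrow> y \<notin> {a<..}"
        using wfE_min[OF wf, of top "{a<..}"] by auto
      then show "\<exists>n>a. \<forall>x>a. n \<le> x"
        by (auto intro!: exI[of _ n] simp: not_less[symmetric])
    qed
  next
    assume suc: "has_successors TYPE('a)"
    show "wf {(x :: 'a, y). x < y}"
    proof (rule wfI_min)
      fix q :: 'a and Q
      assume q: "q \<in> Q"
      show "\<exists>z\<in>Q. \<forall>y. (y, z) \<in> {(x, y). x < y} \<longrightarrow> y \<notin> Q"
      proof (cases "Inf Q \<in> Q")
        case True
        then show ?thesis
          by (metis Inf_lower case_prodD leD mem_Collect_eq)
      next
        case False
        have above: "Inf Q < z" if "z \<in> Q" for z
          using that False Inf_lower[OF that] by (metis order_le_less)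
        then have "Inf Q \<noteq> top"
          using q by force
        then obtain n where "n > Inf Q" "\<forall>x>Inf Q. n \<le> x"
          using suc unfolding has_successors_def by blast
        then have "n \<le> Inf Q"
          using above by (intro Inf_greatest) auto
        with \<open>n > Inf Q\<close> show ?thesis
          by simp
      qed
    qed
  qed
  finally show ?thesis .
qed

text \<open>The complement cuts exactly at the elements outside \<open>M\<close>. If \<open>t\<close> identifies \<open>a\<close> with something
  larger, then \<open>a\<close> is such a cut and separates the two, so the meet is trivial. No cut separates an
  \<open>m \<in> M\<close> from its successor, because only \<open>m\<close> itself could; this makes the join total.\<close>

lemma complemented_if_successors:
  fixes t :: "'a::complete_linorder congruence"
  assumes suc: "has_successors TYPE('a)"
  shows "complemented t"
proof -
  define M where "M = {m. \<forall>y. (m, y) \<in> rel t \<longrightarrow> y \<le> m}"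
  define u where "u = cut_congruence (- M)"
  have rel_u: "(a, b) \<in> rel u \<longleftrightarrow> (\<forall>x. x \<notin> M \<longrightarrow> (a \<le> x \<longleftrightarrow> b \<le> x))" for a b
    by (auto simp: u_def cut_congruence.rep_eq)
  have le: "b \<le> a" if "(a, b) \<in> rel t" "(a, b) \<in> rel u" for a b
    using that by (cases "a \<in> M") (auto simp: M_def rel_u)
  have "rel (inf t u) \<subseteq> Id"
  proof (clarsimp simp: inf_congruence.rep_eq)
    fix a b
    assume ab: "(a, b) \<in> rel t" "(a, b) \<in> rel u"
    then have "(b, a) \<in> rel t" "(b, a) \<in> rel u"
      by (auto intro: congruence_sym[OF frame_congruence_rel])
    with ab show "a = b"
      by (auto intro: antisym le)
  qed
  then have "inf t u = bot"
    by (simp add: less_eq_congruence.rep_eq rel_bot flip: bot_unique)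
  moreover have "sup t u = top"
  proof -
    let ?s = "sup t u"
    have ts: "rel t \<subseteq> rel ?s" and us: "rel u \<subseteq> rel ?s"
      by (simp_all flip: less_eq_congruence.rep_eq)
    have to_top: "(a, top) \<in> rel ?s" for a
    proof -
      define m where "m = Sup {b. (a, b) \<in> rel ?s}"
      have am: "(a, m) \<in> rel ?s"
        unfolding m_def by (rule rel_class_Sup)
      have max: "y \<le> m" if "(m, y) \<in> rel ?s" for y
        unfolding m_def
        using congruence_trans[OF frame_congruence_rel am that] by (simp add: Sup_upper)
      have "m \<in> M"
        using max ts by (auto simp: M_def)
      have "m = top"
      proof (rule ccontr)
        assume "m \<noteq> top"
        then obtain n where n: "n > m" "\<forall>x>m. n \<le> x"
          using suc by (auto simp: has_successors_def)
        have "(m, n) \<in> rel u"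
          unfolding rel_u
        proof (intro allI impI iffI)
          fix x
          assume "x \<notin> M"
          show "n \<le> x" if "m \<le> x"
            using that n \<open>m \<in> M\<close> \<open>x \<notin> M\<close> by (metis order_le_less)
          show "m \<le> x" if "n \<le> x"
            using that n(1) by simp
        qed
        then show False
          using max us n(1) by fastforce
      qed
      with am show ?thesis
        by simp
    qed
    have "(a, b) \<in> rel ?s" for a b
      by (rule congruence_trans[OF frame_congruence_rel to_top
            congruence_sym[OF frame_congruence_rel to_top]])
    then have "rel top \<subseteq> rel ?s"
      by auto
    then show ?thesis
      by (simp add: top_unique flip: less_eq_congruence.rep_eq)
  qed
  ultimately show ?thesis
    unfolding complemented_def by blast
qed

lemma successor_if_complemented:
  fixes a :: "'a::complete_linorder"
  assumes compl: "complemented (cut_congruence {a})" and a: "a \<noteq> top"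
  shows "\<exists>n>a. \<forall>x>a. n \<le> x"
proof (rule ccontr)
  assume no_suc: "\<not> (\<exists>n>a. \<forall>x>a. n \<le> x)"
  let ?t = "cut_congruence {a}"
  have rel_t: "(x, y) \<in> rel ?t \<longleftrightarrow> (x \<le> a \<longleftrightarrow> y \<le> a)" for x y
    by (simp add: cut_congruence.rep_eq)
  obtain u where inf: "inf ?t u = bot" and sup: "sup ?t u = top"
    using compl by (auto simp: complemented_def)
  have "rel ?t \<inter> rel u = Id"
    using inf by (simp add: rel_bot flip: inf_congruence.rep_eq)
  then have trivial: "x = y" if "(x, y) \<in> rel u" "x \<le> a \<longleftrightarrow> y \<le> a" for x y
    using that rel_t[of x y] by blast
  have no_crossing: "(x, y) \<notin> rel u" if "x \<le> a" "a < y" for x y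
  proof
    assume xy: "(x, y) \<in> rel u"
    obtain c where c: "a < c" "c < y"
      using no_suc \<open>a < y\<close> by (auto simp: not_le)
    with that xy have "(c, y) \<in> rel u"
      by (intro rel_convex[OF xy]) auto
    then show False
      using trivial[of c y] c that(2) by (simp add: not_le[symmetric])
  qed
  have "rel u \<subseteq> Id"
  proof clarify
    fix x y
    assume xy: "(x, y) \<in> rel u"
    then have "(y, x) \<in> rel u"
      by (rule congruence_sym[OF frame_congruence_rel])
    with xy show "x = y"
      using no_crossing[of x y] no_crossing[of y x] trivial[of x y] by (metis not_le)
  qed
  then have "u \<le> bot"
    by (simp add: less_eq_congruence.rep_eq rel_bot)
  then have "?t = top"
    using sup by (simp add: bot_unique)
  then have "(a, top) \<in> rel ?t"
    by (simp add: rel_top)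
  with a show False
    by (simp add: rel_t top_unique)
qed

theorem mainTheorem8:
  shows "boolean_frame TYPE('a::complete_linorder congruence)
    \<longleftrightarrow> well_order {(x :: 'a, y). x \<le> y}"
  unfolding well_order_iff_successors
proof
  assume "boolean_frame TYPE('a congruence)"
  then show "has_successors TYPE('a)"
    unfolding boolean_frame_def has_successors_def by (blast intro: successor_if_complemented)
next
  assume "has_successors TYPE('a)"
  then show "boolean_frame TYPE('a congruence)"
    unfolding boolean_frame_def by (blast intro: complemented_if_successors)
qed

end
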